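(* Let $\varphi_1:\mathbb R^p\to\mathbb R$ be differentiable with Lipschitz continuous gradient, let $\varphi_2:\mathbb R^p\to\mathbb R\cup\{\infty\}$ be proper and lower semicontinuous, and suppose that $\varphi=\varphi_1+\varphi_2$ satisfies $\operatorname{argmin}\varphi\ne\emptyset$. Consider the iterates generated by the adaptive DRS algorithm described in the context. Then: (i) The residual $(u^k-v^k)_k$ vanishes with rate $\min_{i\le k}\|u^i-v^i\|=o(1/\sqrt k)$. (ii) $(u^k)_k$ and $(v^k)_k$ have the same cluster points, all of which are stationary for $\varphi$ and on which $\varphi$ has the same value, this being the limit of $(\mathcal L_k)_k$.
   Context: Notation: $\operatorname{prox}_{\gamma h}(x)=\operatorname{argmin}_w\{h(w)+\frac1{2\gamma}\|w-x\|^2\}$ (possibly set-valued). $\mathrm{DRS}_{\gamma,\lambda}(s)$ is the set of triplets $(u,v,s^+)$ with $u\in\operatorname{prox}_{\gamma\varphi_1}(s)$, $v\in\operatorname{prox}_{\gamma\varphi_2}(2u-s)$, $s^+=s+\lambda(v-u)$. $\mathcal L_\beta(x,z,y)=\varphi_1(x)+\varphi_2(z)+\langle y,x-z\rangle+\frac\beta2\|x-z\|^2$. $[r]_+=\max\{0,r\}$. A point $x$ is stationary for $\varphi$ if $0\in\hat\partial\varphi(x)$, where $v\in\hat\partial\varphi(\bar x)$ iff $\liminf_{x\to\bar x,\,x\ne\bar x}\frac{\varphi(x)-\varphi(\bar x)-\langle v,x-\bar x\rangle}{\|x-\bar x\|}\ge0$. Adaptive DRS algorithm. Input: $s^0\in\mathbb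 R^p$, an estimate $L>0$ (not necessarily an upper bound on the Lipschitz modulus of $\nabla\varphi_1$), $\lambda\in(0,2)$, and $\gamma>0$, $c>0$ chosen as follows: either $\gamma<\frac{2-\lambda}{2L}$ and $c=\frac{2-\lambda}{2\lambda\gamma}-\frac L\lambda$, or, if $\varphi_1$ is convex, $\gamma<\frac1L$ and $c=\frac{2-\lambda}{2\lambda\gamma}-L\left[\frac{\gamma L}{\lambda}-\frac12\right]_+$. Initialize $(u^0,v^0,s^1)\in\mathrm{DRS}_{\gamma,\lambda}(s^0)$, $\mathcal L_0=\mathcal L_{1/\gamma}(u^0,v^0,\gamma^{-1}(u^0-s^0))$. For $k=1,2,\dots$: Step 1: choose $(u^k,v^k,s^{k+1})\in\mathrm{DRS}_{\gamma,\lambda}(s^k)$ and set $\mathcal L_k=\mathcal L_{1/\gamma}(u^k,v^k,\gamma^{-1}(u^k-s^k))$. Step 2: if $\mathcal L_k>\mathcal L_{k-1}-\frac{c\lambda^2}{(1+\gamma L)^2}\|v^{k-1}-u^{k-1}\|^2$ or $\varphi(v^k)>\mathcal L_k$, then replace $\gamma\leftarrow\gamma/2$, $c\leftarrow2c$, $L\leftarrow2L$, choose anew $(u^{k-1},v^{k-1},s^k)\in\mathrm{DRS}_{\gamma,\lambda}(s^{k-1})$, set $\mathcal L_{k-1}\leftarrow\mathcal L_{1/\gamma}(u^{k-1},v^{k-1},\gamma^{-1}(u^{k-1}-s^{k-1}))$, and return to Step 1 with the same $k$; otherwise proceed to $k+1$. All prox sets from which the algorithm selects are presumed nonempty, so that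 the iterates are defined. *)

theory Defs
  imports "HOL-Analysis.Analysis" "HOL-Library.Landau_Symbols"
begin

definition proper :: "('a \<Rightarrow> ereal) \<Rightarrow> bool" where
  "proper f \<longleftrightarrow> (\<forall>x. f x \<noteq> -\<infinity>) \<and> (\<exists>x. f x \<noteq> \<infinity>)"

definition lsc :: "('a::topological_space \<Rightarrow> ereal) \<Rightarrow> bool" where
  "lsc f \<longleftrightarrow> (\<forall>x. f x \<le> Liminf (at x) f)"

definition argmin :: "('a \<Rightarrow> ereal) \<Rightarrow> 'a set" where
  "argmin f = {x. is_arg_min f (\<lambda>_. True) x}"

definition prox :: "real \<Rightarrow> ('a::real_normed_vector \<Rightarrow> ereal) \<Rightarrow> 'a \<Rightarrow> 'a set" where
  "prox \<gamma> h x = argmin (\<lambda>w. h w + ereal (1 / (2 * \<gamma>) * (norm (w - x))\<^sup>2))"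

text \<open>The regular (Frechet) subdifferential. As usual it is empty outside the domain of the
  function; the finiteness condition also keeps the difference \<open>f y - f x\<close> meaningful.\<close>

definition frechet_subdiff :: "('a::real_inner \<Rightarrow> ereal) \<Rightarrow> 'a \<Rightarrow> 'a set" where
  "frechet_subdiff f x = {v. \<bar>f x\<bar> \<noteq> \<infinity> \<and>
     0 \<le> Liminf (at x) (\<lambda>y. (f y - f x - ereal (v \<bullet> (y - x))) / ereal (norm (y - x)))}"

definition stationary :: "('a::real_inner \<Rightarrow> ereal) \<Rightarrow> 'a \<Rightarrow> bool" where
  "stationary f x \<longleftrightarrow> 0 \<in> frechet_subdiff f x"

definition cluster_points :: "(nat \<Rightarrow> 'a::topological_space) \<Rightarrow> 'a set" where
  "cluster_points X = {x. \<exists>r. strict_mono r \<and> (X \<circ> r) \<longlonglongrightarrow> x}"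

definition total_cost :: "('a \<Rightarrow> real) \<Rightarrow> ('a \<Rightarrow> ereal) \<Rightarrow> 'a \<Rightarrow> ereal" where
  "total_cost \<phi>1 \<phi>2 x = ereal (\<phi>1 x) + \<phi>2 x"

definition aug_lagrangian ::
    "('a::real_inner \<Rightarrow> real) \<Rightarrow> ('a \<Rightarrow> ereal) \<Rightarrow> real \<Rightarrow> 'a \<Rightarrow> 'a \<Rightarrow> 'a \<Rightarrow> ereal" where
  "aug_lagrangian \<phi>1 \<phi>2 \<beta> x z y =
     ereal (\<phi>1 x) + \<phi>2 z + ereal (y \<bullet> (x - z)) + ereal (\<beta> / 2 * (norm (x - z))\<^sup>2)"

definition DRS ::
    "('a::real_inner \<Rightarrow> real) \<Rightarrow> ('a \<Rightarrow> ereal) \<Rightarrow> real \<Rightarrow> real \<Rightarrow> 'a \<Rightarrow> ('a \<times> 'a \<times> 'a) set" where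
  "DRS \<phi>1 \<phi>2 \<gamma> lam s = {(u, v, s'). u \<in> prox \<gamma> (\<lambda>x. ereal (\<phi>1 x)) s \<and>
     v \<in> prox \<gamma> \<phi>2 (2 *\<^sub>R u - s) \<and> s' = s + lam *\<^sub>R (v - u)}"

definition DRS_lagrangian ::
    "('a::real_inner \<Rightarrow> real) \<Rightarrow> ('a \<Rightarrow> ereal) \<Rightarrow> real \<Rightarrow> 'a \<Rightarrow> 'a \<Rightarrow> 'a \<Rightarrow> ereal" where
  "DRS_lagrangian \<phi>1 \<phi>2 \<gamma> s u v =
     aug_lagrangian \<phi>1 \<phi>2 (1 / \<gamma>) u v ((1 / \<gamma>) *\<^sub>R (u - s))"

definition adaptive_params ::
    "('a::real_vector \<Rightarrow> real) \<Rightarrow> real \<Rightarrow> real \<Rightarrow> real \<Rightarrow> real \<Rightarrow> bool" where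
  "adaptive_params \<phi>1 lam L \<gamma> c \<longleftrightarrow> 0 < \<gamma> \<and> 0 < c \<and>
     (\<gamma> < (2 - lam) / (2 * L) \<and> c = (2 - lam) / (2 * lam * \<gamma>) - L / lam
      \<or> convex_on UNIV \<phi>1 \<and> \<gamma> < 1 / L \<and>
        c = (2 - lam) / (2 * lam * \<gamma>) - L * max 0 (\<gamma> * L / lam - 1 / 2))"

text \<open>A state holds the counter \<open>k\<close> and the current \<open>\<gamma>, c, L\<close>. The variables
  \<open>s\<^sup>k, u\<^sup>k, v\<^sup>k, \<L>\<^sub>k\<close> are kept in arrays, since the algorithm overwrites
  some of them when it backtracks. Entries that have not been assigned yet are arbitrary.\<close>

record 'a adrs_state =
  cnt :: nat
  gam :: real
  cst :: real
  lip :: real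
  sq :: "nat \<Rightarrow> 'a"
  uq :: "nat \<Rightarrow> 'a"
  vq :: "nat \<Rightarrow> 'a"
  lagq :: "nat \<Rightarrow> ereal"

definition adrs_init ::
    "('a::real_inner \<Rightarrow> real) \<Rightarrow> ('a \<Rightarrow> ereal) \<Rightarrow> real \<Rightarrow> 'a \<Rightarrow> real \<Rightarrow> real \<Rightarrow> real \<Rightarrow>
      'a adrs_state \<Rightarrow> bool" where
  "adrs_init \<phi>1 \<phi>2 lam s0 L \<gamma> c \<sigma> \<longleftrightarrow>
     cnt \<sigma> = 1 \<and> gam \<sigma> = \<gamma> \<and> cst \<sigma> = c \<and> lip \<sigma> = L \<and> sq \<sigma> 0 = s0 \<and>
     (uq \<sigma> 0, vq \<sigma> 0, sq \<sigma> 1) \<in> DRS \<phi>1 \<phi>2 \<gamma> lam s0 \<and>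
     lagq \<sigma> 0 = DRS_lagrangian \<phi>1 \<phi>2 \<gamma> s0 (uq \<sigma> 0) (vq \<sigma> 0)"

definition write_triplet ::
    "('a::real_inner \<Rightarrow> real) \<Rightarrow> ('a \<Rightarrow> ereal) \<Rightarrow> nat \<Rightarrow> 'a \<times> 'a \<times> 'a \<Rightarrow>
      'a adrs_state \<Rightarrow> 'a adrs_state" where
  "write_triplet \<phi>1 \<phi>2 j t \<sigma> = (case t of (u, v, s') \<Rightarrow>
     \<sigma>\<lparr>uq := (uq \<sigma>)(j := u), vq := (vq \<sigma>)(j := v), sq := (sq \<sigma>)(Suc j := s'),
       lagq := (lagq \<sigma>)(j := DRS_lagrangian \<phi>1 \<phi>2 (gam \<sigma>) (sq \<sigma> j) u v)\<rparr>)"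

definition must_backtrack ::
    "('a::real_inner \<Rightarrow> real) \<Rightarrow> ('a \<Rightarrow> ereal) \<Rightarrow> real \<Rightarrow> 'a adrs_state \<Rightarrow> bool" where
  "must_backtrack \<phi>1 \<phi>2 lam \<sigma> \<longleftrightarrow> (let k = cnt \<sigma> in
     lagq \<sigma> k > lagq \<sigma> (k - 1) -
       ereal (cst \<sigma> * lam\<^sup>2 / (1 + gam \<sigma> * lip \<sigma>)\<^sup>2 * (norm (vq \<sigma> (k - 1) - uq \<sigma> (k - 1)))\<^sup>2)
     \<or> total_cost \<phi>1 \<phi>2 (vq \<sigma> k) > lagq \<sigma> k)"

definition halve_stepsize :: "'a adrs_state \<Rightarrow> 'a adrs_state" where
  "halve_stepsize \<sigma> = \<sigma>\<lparr>gam := gam \<sigma> / 2, cst := 2 * cst \<sigma>, lip := 2 * lip \<sigma>\<rparr>"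

text \<open>One execution of Step 1 followed by Step 2. The choices from the prox sets are
  nondeterministic, hence a relation between states.\<close>

definition adrs_step ::
    "('a::real_inner \<Rightarrow> real) \<Rightarrow> ('a \<Rightarrow> ereal) \<Rightarrow> real \<Rightarrow>
      'a adrs_state \<Rightarrow> 'a adrs_state \<Rightarrow> bool" where
  "adrs_step \<phi>1 \<phi>2 lam \<sigma> \<tau> \<longleftrightarrow>
     (\<exists>t \<in> DRS \<phi>1 \<phi>2 (gam \<sigma>) lam (sq \<sigma> (cnt \<sigma>)).
        let k = cnt \<sigma>; \<sigma>1 = write_triplet \<phi>1 \<phi>2 k t \<sigma> in
        if must_backtrack \<phi>1 \<phi>2 lam \<sigma>1
        then (let \<sigma>2 = halve_stepsize \<sigma>1 in
              \<exists>t' \<in> DRS \<phi>1 \<phi>2 (gam \<sigma>2) lam (sq \<sigma>2 (k - 1)).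
                \<tau> = write_triplet \<phi>1 \<phi>2 (k - 1) t' \<sigma>2)
        else \<tau> = \<sigma>1\<lparr>cnt := Suc k\<rparr>)"

text \<open>An infinite execution. Its existence encodes that all selections the algorithm had to
  make were possible; it does not presuppose that the counter ever leaves a given value.\<close>

definition adrs_run ::
    "('a::real_inner \<Rightarrow> real) \<Rightarrow> ('a \<Rightarrow> ereal) \<Rightarrow> real \<Rightarrow> 'a \<Rightarrow> real \<Rightarrow> real \<Rightarrow> real \<Rightarrow>
      (nat \<Rightarrow> 'a adrs_state) \<Rightarrow> bool" where
  "adrs_run \<phi>1 \<phi>2 lam s0 L \<gamma> c \<Sigma> \<longleftrightarrow>
     adrs_init \<phi>1 \<phi>2 lam s0 L \<gamma> c (\<Sigma> 0) \<and> (\<forall>n. adrs_step \<phi>1 \<phi>2 lam (\<Sigma> n) (\<Sigma> (Suc n)))"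

text \<open>The sequences generated by a run consist of the final values of the variables: every counter
  value is passed, and from some point on \<open>u\<^sup>k, v\<^sup>k, \<L>\<^sub>k\<close> are no longer
  overwritten. The sequences are uniquely determined by the run.\<close>

definition adrs_generates ::
    "(nat \<Rightarrow> 'a adrs_state) \<Rightarrow> (nat \<Rightarrow> 'a) \<Rightarrow> (nat \<Rightarrow> 'a) \<Rightarrow> (nat \<Rightarrow> ereal) \<Rightarrow> bool" where
  "adrs_generates \<Sigma> u v \<L> \<longleftrightarrow>
     (\<forall>k. \<forall>\<^sub>F n in sequentially.
        k < cnt (\<Sigma> n) \<and> uq (\<Sigma> n) k = u k \<and> vq (\<Sigma> n) k = v k \<and> lagq (\<Sigma> n) k = \<L> k)"

end

theory Submission
  imports Defs
begin

text \<open>The proof rests on the Douglas-Rachford envelope. At a triplet \<open>(u, v, s')\<close> with stepsize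
  \<open>\<gamma>\<close>, optimality of \<open>u\<close> reads \<open>s = u + \<gamma> *\<^sub>R grad u\<close>. Completing the square turns the
  subproblem for \<open>v\<close> into the minimisation of \<open>fb_model \<gamma> u\<close>, the function
  \<open>w \<mapsto> \<phi>1 u + grad u \<bullet> (w - u) + 1 / (2 * \<gamma>) * (norm (w - u))\<^sup>2 + \<phi>2 w\<close>. Its minimal value
  is the augmented Lagrangian recorded by the algorithm
  (\<open>DRS_lagrangian_eq_fb_model\<close>, \<open>DRS_minimises_fb_model\<close>).

  If the estimate \<open>L\<close> is at least the true Lipschitz modulus \<open>K\<close>, both acceptance tests
  succeed: the model decreases enough (\<open>smooth_model_decrease\<close>), and since
  \<open>\<gamma> * L < 1\<close> it majorises the cost (\<open>total_cost_le_fb_model\<close>). Each backtracking step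
  doubles \<open>L\<close>, so there are only finitely many (\<open>finitely_many_backtracks\<close>). The
  relations between \<open>\<gamma>\<close>, \<open>c\<close> and \<open>L\<close> survive a backtracking step because
  \<open>\<gamma> * L\<close> and \<open>\<gamma> * c\<close> are unchanged.

  After the last backtracking step the parameters are constant, but the final \<open>L\<close> may still be
  smaller than \<open>K\<close>. The rest of the proof therefore relies on the two tests that were passed and on
  the optimality of the triplets. By the tests the values \<open>\<L> k\<close> decrease and stay above the minimum of
  the cost. Hence they converge and \<open>(norm (u k - v k))\<^sup>2\<close> is summable
  (\<open>descent_sequence_convergence\<close>), which gives the rate (\<open>min_smallo_inverse_sqrt\<close>).

  Along a subsequence with \<open>u\<close> and \<open>v\<close> converging to \<open>x\<close>, lower semicontinuity lets
  the minimality of \<open>v\<close> pass to the limit: \<open>x\<close> itself minimises \<open>fb_model \<gamma> x\<close>, with value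
  \<open>lim \<L>\<close> (\<open>limit_minimises_fb_model\<close>). This value is the cost of \<open>x\<close>, as the model is
  exact at its base point, and the minimality gives a concave quadratic minorant of the cost
  touching it at \<open>x\<close>. So \<open>0\<close> is a regular subgradient there.\<close>

section \<open>Quadratic bounds for smooth functions\<close>

text \<open>Along the segment from \<open>x\<close> to \<open>y\<close>, the difference of the two sides has nonpositive
  derivative, by the Cauchy-Schwarz inequality and the Lipschitz bound.\<close>
lemma descent_lemma:
  fixes f :: "'a::real_inner \<Rightarrow> real"
  assumes g: "\<And>x. GDERIV f x :> g x" and lip: "L-lipschitz_on UNIV g"
  shows "f y \<le> f x + g x \<bullet> (y - x) + L / 2 * (norm (y - x))\<^sup>2"
proof -
  define d where "d = y - x"
  define h where "h t = f (x + t *\<^sub>R d) - t * (g x \<bullet> d) - L / 2 * t\<^sup>2 * (norm d)\<^sup>2" for t :: real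
  have f': "((\<lambda>t. f (x + t *\<^sub>R d)) has_real_derivative (d \<bullet> g (x + t *\<^sub>R d))) (at t)" for t
  proof -
    have "((\<lambda>t. x + t *\<^sub>R d) has_derivative (\<lambda>t. t *\<^sub>R d)) (at t)"
      by (auto intro!: derivative_eq_intros)
    from has_derivative_compose[OF this, of f "\<lambda>h. h \<bullet> g (x + t *\<^sub>R d)"] g
    show ?thesis by (simp add: gderiv_def has_field_derivative_def mult.commute[of _ "d \<bullet> g _"])
  qed
  have h': "(h has_real_derivative ((g (x + t *\<^sub>R d) - g x) \<bullet> d - L * t * (norm d)\<^sup>2)) (at t)" for t
    unfolding h_def
    by (rule derivative_eq_intros f' refl | simp)+
      (simp add: inner_diff_right inner_diff_left inner_commute)
  have "h 1 \<le> h 0"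
  proof (rule DERIV_nonpos_imp_nonincreasing[OF zero_le_one])
    fix t :: real assume t: "0 \<le> t" "t \<le> 1"
    have "(g (x + t *\<^sub>R d) - g x) \<bullet> d \<le> norm (g (x + t *\<^sub>R d) - g x) * norm d"
      by (rule norm_cauchy_schwarz)
    also have "\<dots> \<le> L * norm (t *\<^sub>R d) * norm d"
      using lipschitz_onD[OF lip, of "x + t *\<^sub>R d" x]
      by (intro mult_right_mono) (auto simp: dist_norm)
    also have "\<dots> = L * t * (norm d)\<^sup>2" using t by (simp add: power2_eq_square)
    finally show "\<exists>y. (h has_real_derivative y) (at t) \<and> y \<le> 0"
      using h'[of t] by (intro exI[of _ "(g (x + t *\<^sub>R d) - g x) \<bullet> d - L * t * (norm d)\<^sup>2"]) auto
  qed
  then show ?thesis by (simp add: h_def d_def)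
qed

lemma descent_lemma_lower:
  fixes f :: "'a::real_inner \<Rightarrow> real"
  assumes g: "\<And>x. GDERIV f x :> g x" and lip: "L-lipschitz_on UNIV g"
  shows "f y \<ge> f x + g x \<bullet> (y - x) - L / 2 * (norm (y - x))\<^sup>2"
proof -
  have "(\<lambda>x. - f x) y \<le> (\<lambda>x. - f x) x + (- g x) \<bullet> (y - x) + L / 2 * (norm (y - x))\<^sup>2"
  proof (rule descent_lemma)
    show "GDERIV (\<lambda>x. - f x) x :> - g x" for x by (rule GDERIV_minus[OF g])
    show "L-lipschitz_on UNIV (\<lambda>x. - g x)" by (rule lipschitz_on_minus[OF lip])
  qed
  then show ?thesis by simp
qed

lemma convex_gradient_inequality:
  fixes f :: "'a::real_inner \<Rightarrow> real"
  assumes g: "GDERIV f x :> d" and conv: "convex_on UNIV f"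
  shows "f y \<ge> f x + d \<bullet> (y - x)"
proof -
  have "((\<lambda>t. x + t *\<^sub>R (y - x)) has_derivative (\<lambda>t. t *\<^sub>R (y - x))) (at (0::real))"
    by (auto intro!: derivative_eq_intros)
  from has_derivative_compose[OF this, of f "\<lambda>h. h \<bullet> d"] g
  have "((\<lambda>t. f (x + t *\<^sub>R (y - x))) has_real_derivative ((y - x) \<bullet> d)) (at (0::real))"
    by (simp add: gderiv_def has_field_derivative_def mult.commute[of _ "_ \<bullet> d"])
  then have "((\<lambda>t. (f (x + t *\<^sub>R (y - x)) - f x) / t) \<longlongrightarrow> (y - x) \<bullet> d) (at_right 0)"
    by (auto simp: has_field_derivative_iff intro: tendsto_within_subset)
  moreover have "\<forall>\<^sub>F t in at_right (0::real). (f (x + t *\<^sub>R (y - x)) - f x) / t \<le> f y - f x"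
  proof -
    have "(f (x + t *\<^sub>R (y - x)) - f x) / t \<le> f y - f x" if t: "0 < t" "t < 1" for t
    proof -
      have "f ((1 - t) *\<^sub>R x + t *\<^sub>R y) \<le> (1 - t) * f x + t * f y"
        using conv t unfolding convex_on_def by simp
      moreover have "(1 - t) *\<^sub>R x + t *\<^sub>R y = x + t *\<^sub>R (y - x)" by (simp add: algebra_simps)
      ultimately have "f (x + t *\<^sub>R (y - x)) - f x \<le> t * (f y - f x)" by (simp add: algebra_simps)
      then show ?thesis using t by (simp add: divide_le_eq mult.commute)
    qed
    then show ?thesis by (auto intro: eventually_at_rightI[of 0 1])
  qed
  ultimately have "(y - x) \<bullet> d \<le> f y - f x"
    by (intro tendsto_upperbound) auto
  then show ?thesis by (simp add: inner_commute)
qed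

text \<open>Compare the tangent at \<open>x\<close>, which convexity puts below \<open>f\<close>, with the quadratic upper
  bound at \<open>y\<close>, both evaluated at the point \<open>z\<close> reached from \<open>y\<close> by a gradient step
  with stepsize \<open>1 / L\<close> for \<open>f\<close> minus its linear part at \<open>x\<close>.\<close>
lemma convex_smooth_lower_bound:
  fixes f :: "'a::real_inner \<Rightarrow> real"
  assumes g: "\<And>x. GDERIV f x :> g x" and lip: "L-lipschitz_on UNIV g"
    and conv: "convex_on UNIV f" and L: "0 < L"
  shows "f y \<ge> f x + g x \<bullet> (y - x) + 1 / (2 * L) * (norm (g y - g x))\<^sup>2"
proof -
  define e where "e = g y - g x"
  define z where "z = y - (1 / L) *\<^sub>R e"
  have "f x + g x \<bullet> (z - x) \<le> f z" by (rule convex_gradient_inequality[OF g conv])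
  also have "\<dots> \<le> f y + g y \<bullet> (z - y) + L / 2 * (norm (z - y))\<^sup>2"
    by (rule descent_lemma[OF g lip])
  also have "L / 2 * (norm (z - y))\<^sup>2 = 1 / (2 * L) * (norm e)\<^sup>2"
    using L by (simp add: z_def power_mult_distrib power2_eq_square divide_simps)
  finally have "f x + g x \<bullet> (z - x) \<le> f y + g y \<bullet> (z - y) + 1 / (2 * L) * (norm e)\<^sup>2" .
  moreover have "g x \<bullet> (z - x) - g y \<bullet> (z - y) = g x \<bullet> (y - x) + 1 / L * (norm e)\<^sup>2"
  proof -
    have "g x \<bullet> (z - x) - g y \<bullet> (z - y) = g x \<bullet> (y - x) - e \<bullet> (z - y)"
      by (simp add: e_def inner_diff_left inner_diff_right)
    then show ?thesis by (simp add: z_def power2_norm_eq_inner)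
  qed
  moreover have "1 / L * (norm e)\<^sup>2 = 2 * (1 / (2 * L) * (norm e)\<^sup>2)" by simp
  ultimately show ?thesis unfolding e_def by linarith
qed

section \<open>Sufficient decrease of the Douglas-Rachford envelope\<close>

text \<open>The quadratic model of \<open>f\<close> at \<open>u\<close> that is used by a forward-backward step. The
  augmented Lagrangian at a Douglas-Rachford triplet, as a function of its second argument, is this
  model plus the nonsmooth term.\<close>
definition smooth_model :: "('a::real_inner \<Rightarrow> real) \<Rightarrow> ('a \<Rightarrow> 'a) \<Rightarrow> real \<Rightarrow> 'a \<Rightarrow> 'a \<Rightarrow> real" where
  "smooth_model f g \<gamma> u w = f u + g u \<bullet> (w - u) + 1 / (2 * \<gamma>) * (norm (w - u))\<^sup>2"

text \<open>Replacing \<open>u\<close> by the next iterate \<open>u'\<close> with \<open>v\<close> kept fixed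
  lowers the model. Put \<open>d = u' - u\<close>, let \<open>e\<close> be the difference of the gradients and
  \<open>A = f u' - f u - g u' \<bullet> d\<close>. The relation \<open>lam *\<^sub>R (v - u) = d + \<gamma> *\<^sub>R e\<close> eliminates
  \<open>v\<close>, the cross terms \<open>e \<bullet> d\<close> cancel, and exactly
  \<open>A + \<gamma> / lam * (norm e)\<^sup>2 - (2 - lam) / (2 * lam * \<gamma>) * (norm d)\<^sup>2\<close> remains. In general,
  \<open>A \<le> L / 2 * (norm d)\<^sup>2\<close> and \<open>norm e \<le> L * norm d\<close>. If \<open>f\<close> is convex, cocoercivity
  gives \<open>A \<le> - 1 / (2 * L) * (norm e)\<^sup>2\<close>, which absorbs part of the middle term. The two
  formulas for \<open>c\<close> are what these two estimates leave, in the first case after using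
  \<open>\<gamma> < (2 - lam) / (2 * L)\<close>. The factor \<open>(1 + \<gamma> * L)\<^sup>2\<close> comes from
  expressing the decrease in terms of \<open>v - u\<close> instead of \<open>d\<close>.\<close>
lemma smooth_model_decrease:
  fixes f :: "'a::real_inner \<Rightarrow> real"
  assumes g: "\<And>x. GDERIV f x :> g x" and lip: "L-lipschitz_on UNIV g"
    and L: "0 < L" and lam: "0 < lam"
    and par: "adaptive_params f lam L \<gamma> c"
    and rel: "u' + \<gamma> *\<^sub>R g u' = u + \<gamma> *\<^sub>R g u + lam *\<^sub>R (v - u)"
  shows "smooth_model f g \<gamma> u' v
    \<le> smooth_model f g \<gamma> u v - c * lam\<^sup>2 / (1 + \<gamma> * L)\<^sup>2 * (norm (v - u))\<^sup>2"
proof -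
  define d where "d = u' - u"
  define e where "e = g u' - g u"
  define A where "A = f u' - f u - g u' \<bullet> d"
  have \<gamma>: "0 < \<gamma>" and c: "0 < c" using par by (auto simp: adaptive_params_def)
  have de: "lam *\<^sub>R (v - u) = d + \<gamma> *\<^sub>R e"
    using rel by (simp add: d_def e_def algebra_simps)
  then have \<delta>: "v - u = (1 / lam) *\<^sub>R (d + \<gamma> *\<^sub>R e)"
    by (metis lam divide_self_if less_irrefl mult.commute scaleR_one scaleR_scaleR times_divide_eq_left mult_1)
  have e_le: "norm e \<le> L * norm d"
    using lipschitz_onD[OF lip, of u' u] by (simp add: d_def e_def dist_norm)
  have e2: "(norm e)\<^sup>2 \<le> L\<^sup>2 * (norm d)\<^sup>2"
    using power_mono[OF e_le, of 2] by (simp add: power_mult_distrib)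
  have vu': "v - u' = (v - u) - d" by (simp add: d_def)
  have "smooth_model f g \<gamma> u' v - smooth_model f g \<gamma> u v
      = A + e \<bullet> (v - u) - 1 / \<gamma> * (d \<bullet> (v - u)) + 1 / (2 * \<gamma>) * (norm d)\<^sup>2"
  proof -
    have expand: "(norm (v - u'))\<^sup>2 = (norm (v - u))\<^sup>2 - 2 * (d \<bullet> (v - u)) + (norm d)\<^sup>2"
      unfolding vu' power2_norm_eq_inner
      by (simp add: inner_diff_left inner_diff_right inner_commute)
    have "g u' \<bullet> (v - u') = g u \<bullet> (v - u) + e \<bullet> (v - u) - g u' \<bullet> d"
      unfolding vu' e_def inner_diff_right[of _ "v - u"] inner_diff_left[of "g u'"] by simp
    then show ?thesis
      unfolding smooth_model_def expand A_def by (simp add: ring_distribs)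
  qed
  also have "\<dots> = A + \<gamma> / lam * (norm e)\<^sup>2 - (2 - lam) / (2 * lam * \<gamma>) * (norm d)\<^sup>2"
    unfolding \<delta> power2_norm_eq_inner using \<gamma> lam
    by (simp add: inner_add_right inner_commute field_simps)
  also have "\<dots> \<le> - c * (norm d)\<^sup>2"
    using par unfolding adaptive_params_def
  proof (elim conjE disjE)
    assume small: "\<gamma> < (2 - lam) / (2 * L)" and ceq: "c = (2 - lam) / (2 * lam * \<gamma>) - L / lam"
    \<comment> \<open>After these bounds the coefficient of \<open>(norm d)\<^sup>2\<close> is \<open>\<gamma> / lam * L\<^sup>2 + L / 2\<close>, and the
      stepsize restriction is just what bounds it by \<open>L / lam\<close>.\<close>
    have "A \<le> L / 2 * (norm d)\<^sup>2"
      using descent_lemma_lower[OF g lip, of u' u]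
      by (simp add: A_def d_def inner_diff_right norm_minus_commute)
    moreover have "\<gamma> / lam * (norm e)\<^sup>2 \<le> \<gamma> / lam * (L\<^sup>2 * (norm d)\<^sup>2)"
      using e2 \<gamma> lam by (intro mult_left_mono) auto
    moreover have "\<gamma> / lam * L\<^sup>2 + L / 2 \<le> L / lam"
    proof -
      have "\<gamma> * L \<le> (2 - lam) / 2" using small L by (simp add: field_simps)
      then have "\<gamma> * L * (L / lam) \<le> (2 - lam) / 2 * (L / lam)"
        using L lam by (intro mult_right_mono) auto
      moreover have "\<gamma> * L * (L / lam) = \<gamma> / lam * L\<^sup>2" by (simp add: power2_eq_square)
      moreover have "(2 - lam) / 2 * (L / lam) = L / lam - L / 2"
        using lam by (simp add: field_simps)
      ultimately show ?thesis by linarith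
    qed
    then have "(\<gamma> / lam * L\<^sup>2 + L / 2) * (norm d)\<^sup>2 \<le> L / lam * (norm d)\<^sup>2"
      by (intro mult_right_mono) auto
    ultimately show ?thesis unfolding ceq by (simp add: algebra_simps)
  next
    assume conv: "convex_on UNIV f"
      and ceq: "c = (2 - lam) / (2 * lam * \<gamma>) - L * max 0 (\<gamma> * L / lam - 1 / 2)"
    have "A \<le> - (1 / (2 * L)) * (norm e)\<^sup>2"
      using convex_smooth_lower_bound[OF g lip conv L, of u' u]
      by (simp add: A_def d_def e_def inner_diff_right norm_minus_commute)
    then have "A + \<gamma> / lam * (norm e)\<^sup>2 \<le> (\<gamma> / lam - 1 / (2 * L)) * (norm e)\<^sup>2"
      by (simp add: algebra_simps)
    \<comment> \<open>The Lipschitz bound on \<open>e\<close> may only be applied to a nonnegative coefficient; hence the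
      positive part in \<open>c\<close>.\<close>
    also have "\<dots> \<le> max 0 (\<gamma> / lam - 1 / (2 * L)) * (norm e)\<^sup>2"
      by (intro mult_right_mono) auto
    also have "\<dots> \<le> max 0 (\<gamma> / lam - 1 / (2 * L)) * (L\<^sup>2 * (norm d)\<^sup>2)"
      using e2 by (intro mult_left_mono) auto
    also have "max 0 (\<gamma> / lam - 1 / (2 * L)) * L\<^sup>2 = L * max 0 (\<gamma> * L / lam - 1 / 2)"
    proof -
      have "\<gamma> * L / lam - 1 / 2 = L * (\<gamma> / lam - 1 / (2 * L))"
        using L by (simp add: field_simps)
      then have "max 0 (\<gamma> * L / lam - 1 / 2) = L * max 0 (\<gamma> / lam - 1 / (2 * L))"
        using L by (auto simp: max_def zero_le_mult_iff)
      then show ?thesis by (simp add: power2_eq_square)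
    qed
    then have "max 0 (\<gamma> / lam - 1 / (2 * L)) * (L\<^sup>2 * (norm d)\<^sup>2)
        = L * max 0 (\<gamma> * L / lam - 1 / 2) * (norm d)\<^sup>2" by (simp add: mult.assoc[symmetric])
    finally show ?thesis unfolding ceq by (simp add: algebra_simps)
  qed
  also have "\<dots> \<le> - (c * lam\<^sup>2 / (1 + \<gamma> * L)\<^sup>2 * (norm (v - u))\<^sup>2)"
  proof -
    have "lam * norm (v - u) = norm (d + \<gamma> *\<^sub>R e)"
      using de lam by (metis abs_of_pos norm_scaleR)
    also have "\<dots> \<le> norm d + \<gamma> * norm e"
      using \<gamma> norm_triangle_ineq[of d "\<gamma> *\<^sub>R e"] by simp
    also have "\<dots> \<le> (1 + \<gamma> * L) * norm d"
      using mult_left_mono[OF e_le, of \<gamma>] \<gamma> by (simp add: algebra_simps)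
    finally have "(lam * norm (v - u))\<^sup>2 \<le> ((1 + \<gamma> * L) * norm d)\<^sup>2"
      using lam by (intro power_mono) auto
    moreover have "0 < 1 + \<gamma> * L" using \<gamma> L by (simp add: add_pos_pos)
    ultimately have "lam\<^sup>2 * (norm (v - u))\<^sup>2 / (1 + \<gamma> * L)\<^sup>2 \<le> (norm d)\<^sup>2"
      by (simp add: power_mult_distrib divide_le_eq mult.commute)
    from mult_left_mono[OF this, of c] c show ?thesis by simp
  qed
  finally show ?thesis by simp
qed

section \<open>Proximal points and stationarity\<close>

lemma prox_smooth_stationarity:
  fixes f :: "'a::real_inner \<Rightarrow> real"
  assumes g: "GDERIV f u :> d" and u: "u \<in> prox \<gamma> (\<lambda>x. ereal (f x)) s" and \<gamma>: "0 < \<gamma>"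
  shows "s = u + \<gamma> *\<^sub>R d"
proof -
  define F where "F w = f w + 1 / (2 * \<gamma>) * (norm (w - s))\<^sup>2" for w
  have "(F has_derivative (\<lambda>h. h \<bullet> d + 1 / (2 * \<gamma>) * (2 * ((u - s) \<bullet> h)))) (at u)"
    using g \<gamma> unfolding gderiv_def F_def power2_norm_eq_inner
    by (auto intro!: derivative_eq_intros simp: inner_commute)
  moreover have "F u \<le> F w" for w
    using u by (auto simp: prox_def argmin_def is_arg_min_linorder F_def)
  ultimately have "(\<lambda>h. h \<bullet> d + 1 / (2 * \<gamma>) * (2 * ((u - s) \<bullet> h))) = (\<lambda>h. 0)"
    by (intro differential_zero_maxmin[of u UNIV F]) auto
  then have "h \<bullet> d + 1 / \<gamma> * ((u - s) \<bullet> h) = 0" for h by (auto dest!: fun_cong[where x = h])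
  then have "h \<bullet> (d + (1 / \<gamma>) *\<^sub>R (u - s)) = 0" for h
    by (simp add: inner_add_right inner_commute[of "u - s"])
  then have "d + (1 / \<gamma>) *\<^sub>R (u - s) = 0" by (metis inner_eq_zero_iff)
  then have "\<gamma> *\<^sub>R (d + (1 / \<gamma>) *\<^sub>R (u - s)) = 0" by simp
  then show ?thesis using \<gamma> by (simp add: scaleR_add_right algebra_simps)
qed

lemma argmin_finite_value:
  assumes "proper h" and v: "v \<in> argmin (\<lambda>w. h w + ereal (q w))"
  shows "\<bar>h v\<bar> \<noteq> \<infinity>"
proof -
  obtain w where w: "h w \<noteq> \<infinity>" and "h v \<noteq> -\<infinity>"
    using assms(1) by (auto simp: proper_def)
  moreover have "h v + ereal (q v) \<le> h w + ereal (q w)"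
    using v by (auto simp: argmin_def is_arg_min_linorder)
  ultimately show ?thesis by auto
qed

text \<open>The difference quotient that defines regular subgradients is at least
  \<open>- M * norm (y - x)\<close>, which vanishes as \<open>y\<close> tends to \<open>x\<close>.\<close>
lemma quadratic_minorant_imp_stationary:
  fixes F :: "'a::{real_inner,perfect_space} \<Rightarrow> ereal"
  assumes fin: "\<bar>F x\<bar> \<noteq> \<infinity>" and minor: "\<And>y. F x - ereal (M * (norm (y - x))\<^sup>2) \<le> F y"
  shows "stationary F x"
proof -
  have "ereal (- M * norm (y - x)) \<le> (F y - F x - ereal (0 \<bullet> (y - x))) / ereal (norm (y - x))"
    if "y \<noteq> x" for y
  proof -
    obtain a where a: "F x = ereal a" using fin by auto
    have pos: "0 < norm (y - x)" using that by simp
    show ?thesis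
    proof (cases "F y")
      case (real b)
      have "- M * (norm (y - x))\<^sup>2 \<le> b - a" using minor[of y] by (simp add: a real)
      then have "- M * norm (y - x) \<le> (b - a) / norm (y - x)"
        using pos by (simp add: le_divide_eq power2_eq_square mult.assoc)
      then show ?thesis using pos by (simp add: a real)
    next
      case PInf
      then show ?thesis using pos by (simp add: a)
    next
      case MInf
      then show ?thesis using minor[of y] by (simp add: a)
    qed
  qed
  then have "Liminf (at x) (\<lambda>y. ereal (- M * norm (y - x)))
      \<le> Liminf (at x) (\<lambda>y. (F y - F x - ereal (0 \<bullet> (y - x))) / ereal (norm (y - x)))"
    by (intro Liminf_mono) (auto simp: eventually_at_filter)
  moreover have "((\<lambda>y. - M * norm (y - x)) \<longlongrightarrow> - M * norm (x - x)) (at x)"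
    by (intro tendsto_intros)
  then have "Liminf (at x) (\<lambda>y. ereal (- M * norm (y - x))) = 0"
    by (intro lim_imp_Liminf) (auto simp: zero_ereal_def)
  ultimately show ?thesis using fin by (simp add: stationary_def frechet_subdiff_def)
qed

text \<open>The limit inferior in \<open>lsc\<close> is over punctured neighbourhoods; the strict inequality at
  \<open>x\<close> itself covers sequences that hit \<open>x\<close>.\<close>
lemma lsc_eventually_gt:
  fixes x :: "'a::topological_space" and X :: "nat \<Rightarrow> 'a"
  assumes "lsc h" and "X \<longlonglongrightarrow> x" and "r < h x"
  shows "\<forall>\<^sub>F n in sequentially. r < h (X n)"
proof -
  have "r < Liminf (at x) h" using assms(1,3) by (auto simp: lsc_def intro: less_le_trans)
  then have "\<forall>\<^sub>F y in at x. r < h y" by (rule less_LiminfD)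
  then have "\<forall>\<^sub>F y in nhds x. r < h y" using assms(3) by (auto simp: eventually_at_filter elim: eventually_mono)
  then show ?thesis using assms(2) by (auto simp: filterlim_iff)
qed

section \<open>Real sequences and cluster points\<close>

lemma cluster_points_subset_of_diff_null:
  fixes X Y :: "nat \<Rightarrow> 'a::real_normed_vector"
  assumes "(\<lambda>k. X k - Y k) \<longlonglongrightarrow> 0"
  shows "cluster_points X \<subseteq> cluster_points Y"
proof
  fix x assume "x \<in> cluster_points X"
  then obtain r :: "nat \<Rightarrow> nat" where r: "strict_mono r" and X: "(X \<circ> r) \<longlonglongrightarrow> x"
    by (auto simp: cluster_points_def)
  have "(\<lambda>n. X (r n) - (X (r n) - Y (r n))) \<longlonglongrightarrow> x - 0"
    using X LIMSEQ_subseq_LIMSEQ[OF assms r] by (intro tendsto_diff) (auto simp: o_def)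
  then have "(Y \<circ> r) \<longlonglongrightarrow> x" by (simp add: o_def)
  then show "x \<in> cluster_points Y" using r by (auto simp: cluster_points_def)
qed

text \<open>About \<open>k / 2\<close> of the squares up to \<open>k\<close> have index at least \<open>k div 2\<close>. Each is at
  least the square of the minimum, while their sum is arbitrarily small by the Cauchy criterion.
  Using the block from \<open>k div 2\<close> rather than the whole sum is what gives little-o instead of
  big-O.\<close>
lemma min_smallo_inverse_sqrt:
  fixes a :: "nat \<Rightarrow> real"
  assumes nonneg: "\<And>k. 0 \<le> a k" and summ: "summable (\<lambda>k. (a k)\<^sup>2)"
  shows "(\<lambda>k. MIN i\<in>{..k}. a i) \<in> o(\<lambda>k. 1 / sqrt (real k))"
proof (rule landau_o.smallI)
  fix e :: real assume e: "0 < e"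
  obtain N where N: "\<And>m n. N \<le> m \<Longrightarrow> norm (\<Sum>i=m..<n. (a i)\<^sup>2) < e\<^sup>2 / 2"
    using summ e unfolding summable_Cauchy by (meson half_gt_zero zero_less_power)
  have "norm (MIN i\<in>{..k}. a i) \<le> e * norm (1 / sqrt (real k))" if k: "2 * N + 1 \<le> k" for k
  proof -
    define m where "m = (MIN i\<in>{..k}. a i)"
    have m: "m \<le> a i" if "i \<le> k" for i unfolding m_def using that by (intro Min_le) auto
    have "m \<in> a ` {..k}" unfolding m_def by (intro Min_in) auto
    then have m0: "0 \<le> m" using nonneg by auto
    have "real k / 2 * m\<^sup>2 \<le> real (card {k div 2..<Suc k}) * m\<^sup>2"
      by (intro mult_right_mono) auto
    also have "\<dots> \<le> (\<Sum>i=k div 2..<Suc k. (a i)\<^sup>2)"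
      using m m0 by (intro sum_bounded_below) (auto intro!: power_mono)
    also have "\<dots> < e\<^sup>2 / 2"
    proof -
      have "N \<le> k div 2" using k by simp
      from N[OF this, of "Suc k"] show ?thesis by simp
    qed
    finally have "(m * sqrt (real k))\<^sup>2 \<le> e\<^sup>2" by (simp add: power_mult_distrib mult.commute)
    then have "m * sqrt (real k) \<le> e" by (rule power2_le_imp_le) (use e in simp)
    then show ?thesis using k m0 by (simp add: m_def[symmetric] le_divide_eq)
  qed
  then show "\<forall>\<^sub>F k in sequentially. norm (MIN i\<in>{..k}. a i) \<le> e * norm (1 / sqrt (real k))"
    unfolding eventually_sequentially by blast
qed

lemma decrease_imp_summable:
  fixes l b :: "nat \<Rightarrow> real"
  assumes "\<And>k. 0 \<le> b k" and dec: "\<And>k. l (Suc k) \<le> l k - b k" and lower: "\<And>k. m \<le> l k"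
  shows "summable b" and "convergent l"
proof -
  have "sum b {..<n} \<le> l 0 - l n" for n
  proof (induction n)
    case (Suc n)
    then show ?case using dec[of n] by simp
  qed simp
  then have "sum b {..<n} \<le> l 0 - m" for n using lower[of n] by (smt (verit))
  then show "summable b" by (intro bounded_imp_summable[of b "l 0 - m"]) (simp_all only: assms(1) lessThan_Suc_atMost[symmetric])
  have "decseq l" using assms(1) dec by (intro decseq_SucI) (smt (verit))
  then show "convergent l" using decseq_convergent[of l m] lower by (metis convergentI)
qed

section \<open>The Douglas-Rachford envelope\<close>

locale composite_problem =
  fixes \<phi>1 :: "'a::euclidean_space \<Rightarrow> real" and \<phi>2 :: "'a \<Rightarrow> ereal" and grad :: "'a \<Rightarrow> 'a" and K :: real
  assumes gderiv: "\<And>x. GDERIV \<phi>1 x :> grad x"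
    and lipschitz: "K-lipschitz_on UNIV grad"
    and proper: "proper \<phi>2"
    and lsc: "lsc \<phi>2"
begin

definition fb_model :: "real \<Rightarrow> 'a \<Rightarrow> 'a \<Rightarrow> ereal" where
  "fb_model \<gamma> u w = ereal (smooth_model \<phi>1 grad \<gamma> u w) + \<phi>2 w"

lemma DRS_input:
  assumes "(u, v, s') \<in> DRS \<phi>1 \<phi>2 \<gamma> lam s" and "0 < \<gamma>"
  shows "s = u + \<gamma> *\<^sub>R grad u" and "s' = s + lam *\<^sub>R (v - u)"
  using assms prox_smooth_stationarity[OF gderiv] by (auto simp: DRS_def)

lemma DRS_finite:
  assumes "(u, v, s') \<in> DRS \<phi>1 \<phi>2 \<gamma> lam s"
  shows "\<bar>\<phi>2 v\<bar> \<noteq> \<infinity>"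
proof -
  have "v \<in> argmin (\<lambda>w. \<phi>2 w + ereal (1 / (2 * \<gamma>) * (norm (w - (2 *\<^sub>R u - s)))\<^sup>2))"
    using assms by (simp only: DRS_def prox_def mem_Collect_eq case_prod_conv)
  from argmin_finite_value[OF proper this] show ?thesis .
qed

lemma DRS_lagrangian_eq_fb_model:
  assumes "(u, v, s') \<in> DRS \<phi>1 \<phi>2 \<gamma> lam s" and \<gamma>: "0 < \<gamma>"
  shows "DRS_lagrangian \<phi>1 \<phi>2 \<gamma> s u v = fb_model \<gamma> u v"
proof -
  have "(1 / \<gamma>) *\<^sub>R (u - s) = - grad u"
    using DRS_input(1)[OF assms] \<gamma> by simp
  moreover obtain r where "\<phi>2 v = ereal r" using DRS_finite[OF assms(1)] by auto
  ultimately show ?thesis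
    by (simp add: DRS_lagrangian_def aug_lagrangian_def fb_model_def smooth_model_def
        inner_diff_right norm_minus_commute)
qed

text \<open>Since \<open>2 *\<^sub>R u - s = u - \<gamma> *\<^sub>R grad u\<close>, expanding the proximal term shows that the
  objective defining \<open>v\<close> differs from \<open>fb_model \<gamma> u\<close> by a constant.\<close>
lemma DRS_minimises_fb_model:
  assumes "(u, v, s') \<in> DRS \<phi>1 \<phi>2 \<gamma> lam s" and \<gamma>: "0 < \<gamma>"
  shows "fb_model \<gamma> u v \<le> fb_model \<gamma> u w"
proof -
  define q where "q z = 1 / (2 * \<gamma>) * (norm (z - (2 *\<^sub>R u - s)))\<^sup>2" for z
  have v: "\<phi>2 v + ereal (q v) \<le> \<phi>2 w + ereal (q w)"
    using assms(1) by (auto simp: DRS_def prox_def argmin_def is_arg_min_linorder q_def)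
  have q: "q z = smooth_model \<phi>1 grad \<gamma> u z + (\<gamma> / 2 * (norm (grad u))\<^sup>2 - \<phi>1 u)" for z
  proof -
    have "z - (2 *\<^sub>R u - s) = (z - u) + \<gamma> *\<^sub>R grad u"
      using DRS_input(1)[OF assms] by (simp add: scaleR_2)
    then have "(norm (z - (2 *\<^sub>R u - s)))\<^sup>2
        = (norm (z - u))\<^sup>2 + 2 * \<gamma> * (grad u \<bullet> (z - u)) + \<gamma>\<^sup>2 * (norm (grad u))\<^sup>2"
      by (simp only: power2_norm_eq_inner inner_add_left inner_add_right inner_scaleR_left
          inner_scaleR_right inner_commute[of "z - u" "grad u"])
        (simp add: power2_eq_square algebra_simps)
    then show ?thesis using \<gamma> by (simp add: q_def smooth_model_def field_simps power2_eq_square)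
  qed
  obtain r where "\<phi>2 v = ereal r" using DRS_finite[OF assms(1)] by auto
  then show ?thesis using v unfolding fb_model_def q by (cases "\<phi>2 w") auto
qed

lemma total_cost_le_fb_model:
  assumes "L-lipschitz_on UNIV grad" and "\<gamma> * L < 1" and "0 < \<gamma>"
  shows "total_cost \<phi>1 \<phi>2 v \<le> fb_model \<gamma> u v"
proof -
  have "L / 2 * (norm (v - u))\<^sup>2 \<le> 1 / (2 * \<gamma>) * (norm (v - u))\<^sup>2"
    using assms(2,3) by (intro mult_right_mono) (auto simp: field_simps)
  then have "\<phi>1 v \<le> smooth_model \<phi>1 grad \<gamma> u v"
    using descent_lemma[OF gderiv assms(1), of v u] by (simp add: smooth_model_def)
  then show ?thesis by (auto simp: total_cost_def fb_model_def intro: add_right_mono)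
qed

text \<open>Up to a multiple of \<open>(norm (y - x))\<^sup>2\<close>, the smooth part of the model at \<open>x\<close> is below
  \<open>\<phi>1\<close>. So minimality of the model at its base point is a quadratic minorant of the cost.
  The true modulus \<open>K\<close> enters only through the curvature of this minorant.\<close>
lemma fb_model_minimal_imp_stationary:
  assumes \<gamma>: "0 < \<gamma>" and min: "\<And>w. fb_model \<gamma> x x \<le> fb_model \<gamma> x w"
  shows "stationary (total_cost \<phi>1 \<phi>2) x"
proof (rule quadratic_minorant_imp_stationary)
  have "x \<in> argmin (\<lambda>w. \<phi>2 w + ereal (smooth_model \<phi>1 grad \<gamma> x w))"
    using min by (auto simp: argmin_def is_arg_min_linorder fb_model_def add.commute)
  from argmin_finite_value[OF proper this] have fin: "\<bar>\<phi>2 x\<bar> \<noteq> \<infinity>" .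
  then show "\<bar>total_cost \<phi>1 \<phi>2 x\<bar> \<noteq> \<infinity>" by (auto simp: total_cost_def)
  fix y
  have "smooth_model \<phi>1 grad \<gamma> x y \<le> \<phi>1 y + (K / 2 + 1 / (2 * \<gamma>)) * (norm (y - x))\<^sup>2"
    using descent_lemma_lower[OF gderiv lipschitz, of x y] by (simp add: smooth_model_def ring_distribs)
  with fin min[of y] show "total_cost \<phi>1 \<phi>2 x - ereal ((K / 2 + 1 / (2 * \<gamma>)) * (norm (y - x))\<^sup>2)
      \<le> total_cost \<phi>1 \<phi>2 y"
    by (cases "\<phi>2 x"; cases "\<phi>2 y") (auto simp: total_cost_def fb_model_def smooth_model_def)
qed

lemma tendsto_smooth_model:
  assumes "u \<longlonglongrightarrow> x" and "v \<longlonglongrightarrow> y"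
  shows "(\<lambda>n. smooth_model \<phi>1 grad \<gamma> (u n) (v n)) \<longlonglongrightarrow> smooth_model \<phi>1 grad \<gamma> x y"
proof -
  have "isCont \<phi>1 x" using gderiv[of x] by (auto simp: gderiv_def intro: has_derivative_continuous)
  moreover have "isCont grad x"
    using lipschitz_on_continuous_on[OF lipschitz] by (simp add: continuous_on_eq_continuous_at)
  ultimately have "(\<lambda>n. \<phi>1 (u n)) \<longlonglongrightarrow> \<phi>1 x" "(\<lambda>n. grad (u n)) \<longlonglongrightarrow> grad x"
    using isCont_tendsto_compose[OF _ assms(1)] by blast+
  then show ?thesis unfolding smooth_model_def by (intro tendsto_intros assms)
qed

text \<open>In the inequality \<open>fb_model \<gamma> (u n) (v n) \<le> fb_model \<gamma> (u n) w\<close> only the smooth part of the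
  right-hand side depends on \<open>n\<close>, so \<open>l'\<close> is a lower bound of the limit model. Lower
  semicontinuity of \<open>\<phi>2\<close> along \<open>v\<close> gives the reverse bound at \<open>w = x\<close>. Taken together
  they show that \<open>\<phi>2 (v n)\<close> converges to \<open>\<phi>2 x\<close>, so no value is lost in the limit.\<close>
lemma limit_minimises_fb_model:
  assumes u: "u \<longlonglongrightarrow> x" and v: "v \<longlonglongrightarrow> x" and lim: "\<And>n. fb_model \<gamma> (u n) (v n) = ereal (l n)" "l \<longlonglongrightarrow> l'"
    and min: "\<And>n w. fb_model \<gamma> (u n) (v n) \<le> fb_model \<gamma> (u n) w"
  shows "fb_model \<gamma> x x \<le> fb_model \<gamma> x w" and "fb_model \<gamma> x x = ereal l'"
proof -
  have le: "ereal l' \<le> fb_model \<gamma> x w" for w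
  proof (cases "\<phi>2 w")
    case (real b)
    have "l n \<le> smooth_model \<phi>1 grad \<gamma> (u n) w + b" for n
      using min[of n w] unfolding lim by (simp add: fb_model_def real)
    moreover have "(\<lambda>n. smooth_model \<phi>1 grad \<gamma> (u n) w + b) \<longlonglongrightarrow> smooth_model \<phi>1 grad \<gamma> x w + b"
      by (intro tendsto_add tendsto_smooth_model u tendsto_const)
    ultimately have "l' \<le> smooth_model \<phi>1 grad \<gamma> x w + b"
      by (intro LIMSEQ_le[OF lim(2)]) auto
    then show ?thesis by (simp add: fb_model_def real)
  qed (use proper in \<open>auto simp: fb_model_def proper_def\<close>)
  have "\<phi>2 x \<le> ereal (l' - smooth_model \<phi>1 grad \<gamma> x x)"
  proof (rule ccontr)
    assume "\<not> ?thesis"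
    then obtain r where r: "ereal (l' - smooth_model \<phi>1 grad \<gamma> x x) < ereal r" "ereal r < \<phi>2 x"
      by (meson ereal_dense2 not_le)
    have "\<forall>\<^sub>F n in sequentially. r \<le> l n - smooth_model \<phi>1 grad \<gamma> (u n) (v n)"
      using lsc_eventually_gt[OF lsc v r(2)]
    proof eventually_elim
      fix n assume gt: "ereal r < \<phi>2 (v n)"
      have "ereal (smooth_model \<phi>1 grad \<gamma> (u n) (v n)) + \<phi>2 (v n) = ereal (l n)"
        using lim(1)[of n] by (simp only: fb_model_def)
      with gt show "r \<le> l n - smooth_model \<phi>1 grad \<gamma> (u n) (v n)"
        by (cases "\<phi>2 (v n)") simp_all
    qed
    then have "r \<le> l' - smooth_model \<phi>1 grad \<gamma> x x"
      by (rule tendsto_lowerbound[OF tendsto_diff[OF lim(2) tendsto_smooth_model[OF u v]]]) simp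
    with r show False by simp
  qed
  then have "fb_model \<gamma> x x \<le> ereal l'" by (cases "\<phi>2 x") (auto simp: fb_model_def)
  with le show "fb_model \<gamma> x x \<le> fb_model \<gamma> x w" "fb_model \<gamma> x x = ereal l'"
    by (metis order.trans, metis order.antisym)
qed

end


section \<open>Finiteness of backtracking\<close>

lemma adaptive_params_halve:
  assumes "adaptive_params f lam L \<gamma> c" and "0 < L"
  shows "adaptive_params f lam (2 * L) (\<gamma> / 2) (2 * c)"
proof -
  have small: "\<gamma> / 2 < a / (2 * L) \<longleftrightarrow> \<gamma> < a / L" for a
    using assms(2) by (simp add: field_simps)
  have half: "a / (2 * lam * (\<gamma> / 2)) = 2 * (a / (2 * lam * \<gamma>))" for a by simp
  have pos: "0 < \<gamma> / 2" "0 < 2 * c" using assms(1) by (simp_all add: adaptive_params_def)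
  from assms(1) consider
      "\<gamma> < (2 - lam) / (2 * L)" "c = (2 - lam) / (2 * lam * \<gamma>) - L / lam"
    | "convex_on UNIV f" "\<gamma> < 1 / L"
      "c = (2 - lam) / (2 * lam * \<gamma>) - L * max 0 (\<gamma> * L / lam - 1 / 2)"
    unfolding adaptive_params_def by blast
  then show ?thesis
  proof cases
    case 1
    have "\<gamma> / 2 < (2 - lam) / (2 * (2 * L))"
      using small[of "(2 - lam) / 2"] 1(1) by (simp only: divide_divide_eq_left)
    moreover have "2 * c = (2 - lam) / (2 * lam * (\<gamma> / 2)) - 2 * L / lam"
      unfolding half 1(2) by (simp only: right_diff_distrib times_divide_eq_right)
    ultimately show ?thesis using pos unfolding adaptive_params_def by blast
  next
    case 2
    have "\<gamma> / 2 < 1 / (2 * L)" using small[of 1] 2(2) by blast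
    moreover have "2 * c = (2 - lam) / (2 * lam * (\<gamma> / 2))
        - 2 * L * max 0 (\<gamma> / 2 * (2 * L) / lam - 1 / 2)"
      unfolding half 2(3) by (simp only: right_diff_distrib mult.assoc) simp
    ultimately show ?thesis using pos 2(1) unfolding adaptive_params_def by blast
  qed
qed

lemma adaptive_params_stepsize:
  assumes "adaptive_params f lam L \<gamma> c" and "0 < L" and "0 < lam"
  shows "\<gamma> * L < 1"
proof -
  have "(2 - lam) / (2 * L) < 1 / L" using assms(2,3) by (simp add: field_simps)
  then have "\<gamma> < 1 / L" using assms(1) by (auto simp: adaptive_params_def)
  then show ?thesis using assms(2) by (simp add: field_simps)
qed

definition holds_triplet ::
    "('a::real_inner \<Rightarrow> real) \<Rightarrow> ('a \<Rightarrow> ereal) \<Rightarrow> real \<Rightarrow> 'a adrs_state \<Rightarrow> nat \<Rightarrow> bool" where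
  "holds_triplet \<phi>1 \<phi>2 lam \<sigma> j \<longleftrightarrow>
     (uq \<sigma> j, vq \<sigma> j, sq \<sigma> (Suc j)) \<in> DRS \<phi>1 \<phi>2 (gam \<sigma>) lam (sq \<sigma> j) \<and>
     lagq \<sigma> j = DRS_lagrangian \<phi>1 \<phi>2 (gam \<sigma>) (sq \<sigma> j) (uq \<sigma> j) (vq \<sigma> j)"

text \<open>Both the current parameters and the triplet at the previous index have to be tracked: the
  acceptance test compares the new Lagrangian with the previous one, and the decrease is guaranteed
  only if both belong to the current stepsize. This is why the algorithm recomputes the previous
  triplet after changing \<open>\<gamma>\<close>.\<close>
definition adrs_invariant ::
    "('a::real_inner \<Rightarrow> real) \<Rightarrow> ('a \<Rightarrow> ereal) \<Rightarrow> real \<Rightarrow> 'a adrs_state \<Rightarrow> bool" where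
  "adrs_invariant \<phi>1 \<phi>2 lam \<sigma> \<longleftrightarrow> 0 < cnt \<sigma> \<and> 0 < lip \<sigma> \<and>
     adaptive_params \<phi>1 lam (lip \<sigma>) (gam \<sigma>) (cst \<sigma>) \<and> holds_triplet \<phi>1 \<phi>2 lam \<sigma> (cnt \<sigma> - 1)"

text \<open>The outcome of a step that accepts its triplet. The counter is reset in the last conjunct because
  \<open>must_backtrack\<close> reads the index to be tested from the counter, which has already moved on.\<close>
definition advances ::
    "('a::real_inner \<Rightarrow> real) \<Rightarrow> ('a \<Rightarrow> ereal) \<Rightarrow> real \<Rightarrow> 'a adrs_state \<Rightarrow> 'a adrs_state \<Rightarrow> bool" where
  "advances \<phi>1 \<phi>2 lam \<sigma> \<tau> \<longleftrightarrow>
     cnt \<tau> = Suc (cnt \<sigma>) \<and> gam \<tau> = gam \<sigma> \<and> cst \<tau> = cst \<sigma> \<and> lip \<tau> = lip \<sigma> \<and>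
     (\<forall>j<cnt \<sigma>. uq \<tau> j = uq \<sigma> j \<and> vq \<tau> j = vq \<sigma> j \<and> lagq \<tau> j = lagq \<sigma> j) \<and>
     \<not> must_backtrack \<phi>1 \<phi>2 lam (\<tau>\<lparr>cnt := cnt \<sigma>\<rparr>)"

lemma holds_triplet_written:
  assumes "t \<in> DRS \<phi>1 \<phi>2 (gam \<sigma>) lam (sq \<sigma> j)"
  shows "holds_triplet \<phi>1 \<phi>2 lam (write_triplet \<phi>1 \<phi>2 j t \<sigma>) j"
  using assms by (auto simp: holds_triplet_def write_triplet_def split: prod.splits)

text \<open>Writing at index \<open>Suc i\<close> overwrites \<open>sq\<close> only at \<open>Suc (Suc i)\<close>, hence the value
  \<open>sq \<sigma> (Suc i)\<close> that belongs to the triplet at \<open>i\<close> stays intact.\<close>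
lemma holds_triplet_preserved:
  assumes "holds_triplet \<phi>1 \<phi>2 lam \<sigma> i" and "i < j"
  shows "holds_triplet \<phi>1 \<phi>2 lam (write_triplet \<phi>1 \<phi>2 j t \<sigma>) i"
  using assms by (auto simp: holds_triplet_def write_triplet_def split: prod.splits)

lemma write_triplet_params [simp]:
  "cnt (write_triplet \<phi>1 \<phi>2 j t \<sigma>) = cnt \<sigma>" "gam (write_triplet \<phi>1 \<phi>2 j t \<sigma>) = gam \<sigma>"
  "cst (write_triplet \<phi>1 \<phi>2 j t \<sigma>) = cst \<sigma>" "lip (write_triplet \<phi>1 \<phi>2 j t \<sigma>) = lip \<sigma>"
  by (simp_all add: write_triplet_def split: prod.splits)

lemma holds_triplet_cnt_update [simp]:
  "holds_triplet \<phi>1 \<phi>2 lam (\<sigma>\<lparr>cnt := k\<rparr>) j = holds_triplet \<phi>1 \<phi>2 lam \<sigma> j"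
  by (simp add: holds_triplet_def)

context composite_problem
begin

text \<open>The new Lagrangian is a minimum over \<open>w\<close>, so it is at most the new model at the old
  \<open>v\<close>, to which the sufficient decrease applies.\<close>
lemma no_backtrack_if_true_modulus:
  assumes K: "K \<le> lip \<sigma>" and L: "0 < lip \<sigma>" and lam: "0 < lam"
    and par: "adaptive_params \<phi>1 lam (lip \<sigma>) (gam \<sigma>) (cst \<sigma>)"
    and cnt: "cnt \<sigma> = Suc j"
    and old: "holds_triplet \<phi>1 \<phi>2 lam \<sigma> j" and new: "holds_triplet \<phi>1 \<phi>2 lam \<sigma> (Suc j)"
  shows "\<not> must_backtrack \<phi>1 \<phi>2 lam \<sigma>"
proof -
  let ?u = "uq \<sigma> j" and ?v = "vq \<sigma> j" and ?u' = "uq \<sigma> (Suc j)" and ?v' = "vq \<sigma> (Suc j)"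
  let ?\<gamma> = "gam \<sigma>"
  let ?C = "cst \<sigma> * lam\<^sup>2 / (1 + ?\<gamma> * lip \<sigma>)\<^sup>2 * (norm (?v - ?u))\<^sup>2"
  have \<gamma>: "0 < ?\<gamma>" using par by (simp add: adaptive_params_def)
  have lip: "(lip \<sigma>)-lipschitz_on UNIV grad" using lipschitz K by (rule lipschitz_on_le)
  note old = old[unfolded holds_triplet_def] and new = new[unfolded holds_triplet_def]
  have lag: "lagq \<sigma> j = fb_model ?\<gamma> ?u ?v"
    using old DRS_lagrangian_eq_fb_model[OF _ \<gamma>] by auto
  have lag': "lagq \<sigma> (Suc j) = fb_model ?\<gamma> ?u' ?v'"
    using new DRS_lagrangian_eq_fb_model[OF _ \<gamma>] by auto
  obtain b where b: "\<phi>2 ?v = ereal b" using old DRS_finite by blast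
  have rel: "?u' + ?\<gamma> *\<^sub>R grad ?u' = ?u + ?\<gamma> *\<^sub>R grad ?u + lam *\<^sub>R (?v - ?u)"
    using old new DRS_input[OF _ \<gamma>] by metis
  have "fb_model ?\<gamma> ?u' ?v' \<le> fb_model ?\<gamma> ?u' ?v"
    using new DRS_minimises_fb_model[OF _ \<gamma>] by blast
  also have "\<dots> \<le> fb_model ?\<gamma> ?u ?v - ereal ?C"
    using smooth_model_decrease[OF gderiv lip L lam par rel] by (simp add: fb_model_def b)
  finally have "lagq \<sigma> (Suc j) \<le> lagq \<sigma> j - ereal ?C" by (simp only: lag lag')
  moreover have "total_cost \<phi>1 \<phi>2 ?v' \<le> lagq \<sigma> (Suc j)"
    unfolding lag'
    by (rule total_cost_le_fb_model[OF lip adaptive_params_stepsize[OF par L lam] \<gamma>])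
  ultimately show ?thesis unfolding must_backtrack_def cnt Let_def by (simp add: not_less)
qed

lemma adrs_step_outcome:
  assumes inv: "adrs_invariant \<phi>1 \<phi>2 lam \<sigma>" and step: "adrs_step \<phi>1 \<phi>2 lam \<sigma> \<tau>" and lam: "0 < lam"
  shows "adrs_invariant \<phi>1 \<phi>2 lam \<tau>"
    and "advances \<phi>1 \<phi>2 lam \<sigma> \<tau> \<or> lip \<tau> = 2 * lip \<sigma> \<and> lip \<sigma> < K"
proof -
  obtain j where j: "cnt \<sigma> = Suc j" using inv by (auto simp: adrs_invariant_def gr0_conv_Suc)
  from inv have L: "0 < lip \<sigma>" and par: "adaptive_params \<phi>1 lam (lip \<sigma>) (gam \<sigma>) (cst \<sigma>)"
    and old: "holds_triplet \<phi>1 \<phi>2 lam \<sigma> j" by (auto simp: adrs_invariant_def j)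
  obtain t where t: "t \<in> DRS \<phi>1 \<phi>2 (gam \<sigma>) lam (sq \<sigma> (Suc j))"
    and cont: "if must_backtrack \<phi>1 \<phi>2 lam (write_triplet \<phi>1 \<phi>2 (Suc j) t \<sigma>)
      then \<exists>t' \<in> DRS \<phi>1 \<phi>2 (gam (halve_stepsize (write_triplet \<phi>1 \<phi>2 (Suc j) t \<sigma>))) lam
             (sq (halve_stepsize (write_triplet \<phi>1 \<phi>2 (Suc j) t \<sigma>)) j).
             \<tau> = write_triplet \<phi>1 \<phi>2 j t' (halve_stepsize (write_triplet \<phi>1 \<phi>2 (Suc j) t \<sigma>))
      else \<tau> = (write_triplet \<phi>1 \<phi>2 (Suc j) t \<sigma>)\<lparr>cnt := Suc (Suc j)\<rparr>"
    using step unfolding adrs_step_def Let_def j diff_Suc_1 by blast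
  define \<rho> where "\<rho> = write_triplet \<phi>1 \<phi>2 (Suc j) t \<sigma>"
  have new: "holds_triplet \<phi>1 \<phi>2 lam \<rho> (Suc j)" unfolding \<rho>_def by (rule holds_triplet_written[OF t])
  have old': "holds_triplet \<phi>1 \<phi>2 lam \<rho> j" unfolding \<rho>_def by (rule holds_triplet_preserved[OF old]) simp
  have \<rho>: "cnt \<rho> = Suc j" "gam \<rho> = gam \<sigma>" "cst \<rho> = cst \<sigma>" "lip \<rho> = lip \<sigma>"
    by (simp_all add: \<rho>_def j)
  have "adrs_invariant \<phi>1 \<phi>2 lam \<tau> \<and>
    (advances \<phi>1 \<phi>2 lam \<sigma> \<tau> \<or> lip \<tau> = 2 * lip \<sigma> \<and> lip \<sigma> < K)"
  proof (cases "must_backtrack \<phi>1 \<phi>2 lam \<rho>")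
    case True
    then obtain t' where t': "t' \<in> DRS \<phi>1 \<phi>2 (gam (halve_stepsize \<rho>)) lam (sq (halve_stepsize \<rho>) j)"
      and \<tau>: "\<tau> = write_triplet \<phi>1 \<phi>2 j t' (halve_stepsize \<rho>)"
      using cont unfolding \<rho>_def by auto
    have \<tau>_params: "cnt \<tau> = Suc j" "gam \<tau> = gam \<sigma> / 2" "cst \<tau> = 2 * cst \<sigma>" "lip \<tau> = 2 * lip \<sigma>"
      by (simp_all add: \<tau> halve_stepsize_def \<rho>)
    have "holds_triplet \<phi>1 \<phi>2 lam \<tau> j" unfolding \<tau> by (rule holds_triplet_written[OF t'])
    then have "adrs_invariant \<phi>1 \<phi>2 lam \<tau>"
      using adaptive_params_halve[OF par L] L by (simp add: adrs_invariant_def \<tau>_params)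
    moreover have "lip \<sigma> < K"
      using no_backtrack_if_true_modulus[of \<rho> lam j] True old' new L lam par
      by (auto simp: \<rho> not_less[symmetric])
    ultimately show ?thesis by (simp add: \<tau>_params)
  next
    case False
    then have \<tau>: "\<tau> = \<rho>\<lparr>cnt := Suc (Suc j)\<rparr>" using cont by (simp add: \<rho>_def)
    have "adrs_invariant \<phi>1 \<phi>2 lam \<tau>"
      using new L par by (simp add: adrs_invariant_def \<tau> \<rho>)
    moreover have "advances \<phi>1 \<phi>2 lam \<sigma> \<tau>"
    proof -
      have "\<tau>\<lparr>cnt := cnt \<sigma>\<rparr> = \<rho>" using \<rho>(1) by (simp add: \<tau> j)
      then have "\<not> must_backtrack \<phi>1 \<phi>2 lam (\<tau>\<lparr>cnt := cnt \<sigma>\<rparr>)" using False by (simp only: not_False_eq_True)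
      moreover have "uq \<rho> i = uq \<sigma> i" "vq \<rho> i = vq \<sigma> i" "lagq \<rho> i = lagq \<sigma> i" if "i < Suc j" for i
        using that by (auto simp: \<rho>_def write_triplet_def split: prod.splits)
      ultimately show ?thesis unfolding advances_def by (simp add: \<tau> \<rho> j)
    qed
    ultimately show ?thesis by blast
  qed
  then show "adrs_invariant \<phi>1 \<phi>2 lam \<tau>"
    and "advances \<phi>1 \<phi>2 lam \<sigma> \<tau> \<or> lip \<tau> = 2 * lip \<sigma> \<and> lip \<sigma> < K" by blast+
qed

lemma adrs_run_invariant:
  assumes run: "adrs_run \<phi>1 \<phi>2 lam s0 L \<gamma> c \<Sigma>" and "0 < lam" "0 < L" "adaptive_params \<phi>1 lam L \<gamma> c"
  shows "adrs_invariant \<phi>1 \<phi>2 lam (\<Sigma> n)"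
proof (induction n)
  case 0
  then show ?case using assms
    by (auto simp: adrs_run_def adrs_init_def adrs_invariant_def holds_triplet_def)
next
  case (Suc n)
  then show ?case using adrs_step_outcome(1) assms by (auto simp: adrs_run_def)
qed

text \<open>Infinitely many backtracking steps would double \<open>lip\<close> beyond \<open>K\<close>, after which none can
  occur.\<close>
lemma finitely_many_backtracks:
  assumes run: "adrs_run \<phi>1 \<phi>2 lam s0 L \<gamma> c \<Sigma>" and lam: "0 < lam" and L: "0 < L"
    and par: "adaptive_params \<phi>1 lam L \<gamma> c"
  obtains N where "\<And>n. N \<le> n \<Longrightarrow> advances \<phi>1 \<phi>2 lam (\<Sigma> n) (\<Sigma> (Suc n))"
proof (rule ccontr)
  assume "\<not> thesis"
  with that have inf: "\<exists>n\<ge>N. \<not> advances \<phi>1 \<phi>2 lam (\<Sigma> n) (\<Sigma> (Suc n))" for N by blast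
  note inv = adrs_run_invariant[OF run lam L par]
  have step: "adrs_step \<phi>1 \<phi>2 lam (\<Sigma> n) (\<Sigma> (Suc n))" for n using run by (simp add: adrs_run_def)
  note outcome = adrs_step_outcome(2)[OF inv step lam]
  have mono: "incseq (\<lambda>n. lip (\<Sigma> n))"
  proof (rule incseq_SucI)
    fix n
    show "lip (\<Sigma> n) \<le> lip (\<Sigma> (Suc n))"
      using outcome[of n] inv[of n] by (auto simp: advances_def adrs_invariant_def)
  qed
  have grow: "\<exists>n. 2 ^ m * L \<le> lip (\<Sigma> n)" for m
  proof (induction m)
    case 0
    have "lip (\<Sigma> 0) = L" using run by (simp add: adrs_run_def adrs_init_def)
    then show ?case by (intro exI[of _ 0]) simp
  next
    case (Suc m)
    then obtain n where n: "2 ^ m * L \<le> lip (\<Sigma> n)" by blast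
    obtain n' where "n \<le> n'" "\<not> advances \<phi>1 \<phi>2 lam (\<Sigma> n') (\<Sigma> (Suc n'))" using inf by blast
    then have "lip (\<Sigma> (Suc n')) = 2 * lip (\<Sigma> n')" "lip (\<Sigma> n) \<le> lip (\<Sigma> n')"
      using outcome[of n'] monoD[OF mono] by auto
    with n show ?case by (intro exI[of _ "Suc n'"]) simp
  qed
  obtain m where "K / L < 2 ^ m" using real_arch_pow[of 2 "K / L"] by auto
  then have "K < 2 ^ m * L" using L by (simp add: divide_less_eq)
  moreover obtain n where "2 ^ m * L \<le> lip (\<Sigma> n)" using grow by blast
  moreover obtain n' where "n \<le> n'" "\<not> advances \<phi>1 \<phi>2 lam (\<Sigma> n') (\<Sigma> (Suc n'))" using inf by blast
  then have "lip (\<Sigma> n) \<le> lip (\<Sigma> n')" "lip (\<Sigma> n') < K"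
    using outcome[of n'] monoD[OF mono] by auto
  ultimately show False by linarith
qed

section \<open>Convergence of the generated sequences\<close>

text \<open>All that the convergence proof uses about the iterates from index \<open>M\<close> on. The constant
  \<open>C\<close> absorbs the final values of \<open>c\<close>, \<open>\<gamma>\<close>, \<open>L\<close> and the relaxation.
  Backtracking may stop before the estimate reaches the Lipschitz modulus of the gradient, so these
  are just the facts that the optimality of the triplets and the passed tests provide.\<close>
definition descent_sequence ::
    "real \<Rightarrow> real \<Rightarrow> nat \<Rightarrow> (nat \<Rightarrow> 'a) \<Rightarrow> (nat \<Rightarrow> 'a) \<Rightarrow> (nat \<Rightarrow> ereal) \<Rightarrow> bool" where
  "descent_sequence \<gamma> C M u v \<L> \<longleftrightarrow> 0 < \<gamma> \<and> 0 < C \<and>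
     (\<forall>k\<ge>M. \<bar>\<phi>2 (v k)\<bar> \<noteq> \<infinity> \<and> \<L> k = fb_model \<gamma> (u k) (v k) \<and>
       (\<forall>w. fb_model \<gamma> (u k) (v k) \<le> fb_model \<gamma> (u k) w) \<and>
       \<L> (Suc k) \<le> \<L> k - ereal (C * (norm (u k - v k))\<^sup>2) \<and>
       total_cost \<phi>1 \<phi>2 (v k) \<le> \<L> k)"

text \<open>From time \<open>N\<close> on every step accepts. The counter is then \<open>k0 + i\<close> at time \<open>N + i\<close>,
  and entries below the counter are never written again, so the value at index \<open>k\<close> can be read
  off at time \<open>N + Suc k\<close>.\<close>
lemma adrs_generates_descent_sequence:
  assumes run: "adrs_run \<phi>1 \<phi>2 lam s0 L \<gamma> c \<Sigma>" and lam: "0 < lam" and L: "0 < L"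
    and par: "adaptive_params \<phi>1 lam L \<gamma> c"
  obtains u v \<L> \<gamma>' C M where "adrs_generates \<Sigma> u v \<L>" and "descent_sequence \<gamma>' C M u v \<L>"
proof -
  obtain N where adv: "\<And>n. N \<le> n \<Longrightarrow> advances \<phi>1 \<phi>2 lam (\<Sigma> n) (\<Sigma> (Suc n))"
    using finitely_many_backtracks[OF run lam L par] by blast
  note inv = adrs_run_invariant[OF run lam L par]
  define k0 where "k0 = cnt (\<Sigma> N)"
  define \<gamma>' c' L' where "\<gamma>' = gam (\<Sigma> N)" and "c' = cst (\<Sigma> N)" and "L' = lip (\<Sigma> N)"
  define C where "C = c' * lam\<^sup>2 / (1 + \<gamma>' * L')\<^sup>2"
  have params: "cnt (\<Sigma> (N + i)) = k0 + i \<and> gam (\<Sigma> (N + i)) = \<gamma>' \<and> cst (\<Sigma> (N + i)) = c' \<and>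
      lip (\<Sigma> (N + i)) = L'" for i
  proof (induction i)
    case (Suc i)
    then show ?case using adv[of "N + i"] by (simp add: advances_def)
  qed (simp add: k0_def \<gamma>'_def c'_def L'_def)
  have k0: "0 < k0" and L': "0 < L'" and par': "adaptive_params \<phi>1 lam L' \<gamma>' c'"
    using inv[of N] by (simp_all add: adrs_invariant_def k0_def \<gamma>'_def c'_def L'_def)
  then have \<gamma>': "0 < \<gamma>'" and c': "0 < c'" by (simp_all add: adaptive_params_def)
  have "0 < 1 + \<gamma>' * L'" using \<gamma>' L' by (simp add: add_pos_pos)
  then have C: "0 < C" using c' lam by (simp add: C_def)
  define u v \<L> where "u k = uq (\<Sigma> (N + Suc k)) k" and "v k = vq (\<Sigma> (N + Suc k)) k"
    and "\<L> k = lagq (\<Sigma> (N + Suc k)) k" for k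
  have stable: "uq (\<Sigma> (N + (i + d))) j = uq (\<Sigma> (N + i)) j \<and> vq (\<Sigma> (N + (i + d))) j = vq (\<Sigma> (N + i)) j
      \<and> lagq (\<Sigma> (N + (i + d))) j = lagq (\<Sigma> (N + i)) j" if "j < k0 + i" for i j d
  proof (induction d)
    case (Suc d)
    have "j < cnt (\<Sigma> (N + (i + d)))" using that params[of "i + d"] by simp
    with adv[of "N + (i + d)"] have "uq (\<Sigma> (Suc (N + (i + d)))) j = uq (\<Sigma> (N + (i + d))) j \<and>
        vq (\<Sigma> (Suc (N + (i + d)))) j = vq (\<Sigma> (N + (i + d))) j \<and>
        lagq (\<Sigma> (Suc (N + (i + d)))) j = lagq (\<Sigma> (N + (i + d))) j"
      by (simp add: advances_def)
    with Suc.IH show ?case by simp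
  qed simp
  have final: "uq (\<Sigma> (N + i)) j = u j \<and> vq (\<Sigma> (N + i)) j = v j \<and> lagq (\<Sigma> (N + i)) j = \<L> j"
    if "j < k0 + i" for i j
  proof -
    have "j < k0 + Suc j" by simp
    from stable[OF that, of "Suc j"] stable[OF this, of i] show ?thesis
      by (simp add: u_def v_def \<L>_def add.commute[of i])
  qed
  have gen: "adrs_generates \<Sigma> u v \<L>"
    unfolding adrs_generates_def
  proof
    fix k
    have "k < cnt (\<Sigma> n) \<and> uq (\<Sigma> n) k = u k \<and> vq (\<Sigma> n) k = v k \<and> lagq (\<Sigma> n) k = \<L> k"
      if "N + Suc k \<le> n" for n
    proof -
      obtain i where n: "n = N + i" "Suc k \<le> i" using \<open>N + Suc k \<le> n\<close>
        by (metis add_leD1 le_add_diff_inverse nat_add_left_cancel_le)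
      then show ?thesis using params[of i] final[of k i] by simp
    qed
    then show "\<forall>\<^sub>F n in sequentially.
        k < cnt (\<Sigma> n) \<and> uq (\<Sigma> n) k = u k \<and> vq (\<Sigma> n) k = v k \<and> lagq (\<Sigma> n) k = \<L> k"
      unfolding eventually_sequentially by blast
  qed
  \<comment> \<open>The triplet at \<open>k0 - 1\<close> is the last one computed by time \<open>N\<close>; it already belongs
    to the final stepsize, by the invariant.\<close>
  have triplet: "\<exists>s s'. (u k, v k, s') \<in> DRS \<phi>1 \<phi>2 \<gamma>' lam s \<and> \<L> k = DRS_lagrangian \<phi>1 \<phi>2 \<gamma>' s (u k) (v k)"
    if "k0 \<le> Suc k" for k
  proof -
    define i where "i = Suc k - k0"
    have i: "Suc k = k0 + i" using \<open>k0 \<le> Suc k\<close> by (simp add: i_def)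
    have "cnt (\<Sigma> (N + i)) - 1 = k" using params[of i] i by simp
    then have "holds_triplet \<phi>1 \<phi>2 lam (\<Sigma> (N + i)) k"
      using inv[of "N + i"] unfolding adrs_invariant_def by simp
    moreover have "k < k0 + i" using i by simp
    ultimately show ?thesis using final[of k i] params[of i] by (auto simp: holds_triplet_def)
  qed
  have accepted: "\<L> (Suc k) \<le> \<L> k - ereal (C * (norm (u k - v k))\<^sup>2) \<and>
      total_cost \<phi>1 \<phi>2 (v (Suc k)) \<le> \<L> (Suc k)" if "k0 \<le> Suc k" for k
  proof -
    define i where "i = Suc k - k0"
    have i: "Suc k = k0 + i" using \<open>k0 \<le> Suc k\<close> by (simp add: i_def)
    have "\<not> must_backtrack \<phi>1 \<phi>2 lam (\<Sigma> (N + Suc i)\<lparr>cnt := Suc k\<rparr>)"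
      using adv[of "N + i"] params[of i] by (simp add: advances_def i)
    moreover have "k < k0 + Suc i" "Suc k < k0 + Suc i" using i by simp_all
    ultimately show ?thesis
      using final[of k "Suc i"] final[of "Suc k" "Suc i"] params[of "Suc i"]
      by (simp add: must_backtrack_def Let_def C_def not_less norm_minus_commute)
  qed
  have "descent_sequence \<gamma>' C k0 u v \<L>"
    unfolding descent_sequence_def
  proof (intro conjI allI impI \<gamma>' C)
    fix k assume k: "k0 \<le> k"
    then obtain s s' where t: "(u k, v k, s') \<in> DRS \<phi>1 \<phi>2 \<gamma>' lam s"
      and lag: "\<L> k = DRS_lagrangian \<phi>1 \<phi>2 \<gamma>' s (u k) (v k)" using triplet[of k] by auto
    show "\<bar>\<phi>2 (v k)\<bar> \<noteq> \<infinity>" by (rule DRS_finite[OF t])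
    show "\<L> k = fb_model \<gamma>' (u k) (v k)" unfolding lag by (rule DRS_lagrangian_eq_fb_model[OF t \<gamma>'])
    show "fb_model \<gamma>' (u k) (v k) \<le> fb_model \<gamma>' (u k) w" for w by (rule DRS_minimises_fb_model[OF t \<gamma>'])
    show "\<L> (Suc k) \<le> \<L> k - ereal (C * (norm (u k - v k))\<^sup>2)" using accepted[of k] k by simp
    show "total_cost \<phi>1 \<phi>2 (v k) \<le> \<L> k" using accepted[of "k - 1"] k k0 by simp
  qed
  with gen show ?thesis using that by blast
qed

lemma descent_sequenceD:
  assumes "descent_sequence \<gamma> C M u v \<L>" and "M \<le> k"
  shows "\<bar>\<phi>2 (v k)\<bar> \<noteq> \<infinity>"
    and "\<L> k = fb_model \<gamma> (u k) (v k)"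
    and "fb_model \<gamma> (u k) (v k) \<le> fb_model \<gamma> (u k) w"
    and "\<L> (Suc k) \<le> \<L> k - ereal (C * (norm (u k - v k))\<^sup>2)"
    and "total_cost \<phi>1 \<phi>2 (v k) \<le> \<L> k"
proof -
  note all = assms(1)[unfolded descent_sequence_def, THEN conjunct2, THEN conjunct2, THEN spec,
      THEN mp, OF assms(2)]
  show "\<bar>\<phi>2 (v k)\<bar> \<noteq> \<infinity>" by (rule all[THEN conjunct1])
  show "\<L> k = fb_model \<gamma> (u k) (v k)" by (rule all[THEN conjunct2, THEN conjunct1])
  show "fb_model \<gamma> (u k) (v k) \<le> fb_model \<gamma> (u k) w"
    by (rule all[THEN conjunct2, THEN conjunct2, THEN conjunct1, THEN spec])
  show "\<L> (Suc k) \<le> \<L> k - ereal (C * (norm (u k - v k))\<^sup>2)"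
    by (rule all[THEN conjunct2, THEN conjunct2, THEN conjunct2, THEN conjunct1])
  show "total_cost \<phi>1 \<phi>2 (v k) \<le> \<L> k"
    by (rule all[THEN conjunct2, THEN conjunct2, THEN conjunct2, THEN conjunct2])
qed

text \<open>The values \<open>\<L> k\<close> are bounded below because they majorise the cost at \<open>v k\<close>, which has
  a minimum. Nothing is claimed about them before index \<open>M\<close>, so the telescoping argument is
  applied to the shifted sequence.\<close>
lemma descent_sequence_convergence:
  assumes ds: "descent_sequence \<gamma> C M u v \<L>" and argmin: "argmin (total_cost \<phi>1 \<phi>2) \<noteq> {}"
  obtains l where "\<L> \<longlonglongrightarrow> ereal l" and "summable (\<lambda>k. (norm (u k - v k))\<^sup>2)"
proof -
  have C: "0 < C" using ds by (simp add: descent_sequence_def)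
  note ds = descent_sequenceD[OF ds]
  define lr where "lr k = real_of_ereal (\<L> (k + M))" for k
  have lr: "\<L> (k + M) = ereal (lr k)" for k
    using ds(1)[of "k + M"] ds(2)[of "k + M"] by (auto simp: lr_def fb_model_def)
  obtain z where z: "\<And>w. total_cost \<phi>1 \<phi>2 z \<le> total_cost \<phi>1 \<phi>2 w"
    using argmin by (auto simp: argmin_def is_arg_min_linorder)
  have "\<bar>\<phi>2 z\<bar> \<noteq> \<infinity>"
  proof -
    obtain w where "\<phi>2 w \<noteq> \<infinity>" "\<phi>2 z \<noteq> -\<infinity>" using proper by (auto simp: proper_def)
    then show ?thesis using z[of w] by (cases "\<phi>2 z"; cases "\<phi>2 w") (auto simp: total_cost_def)
  qed
  then obtain b where b: "\<phi>2 z = ereal b" by auto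
  have lower: "\<phi>1 z + b \<le> lr k" for k
    using order.trans[OF z ds(5)[of "k + M"]] by (simp add: lr total_cost_def b)
  have step: "lr (Suc k) \<le> lr k - C * (norm (u (k + M) - v (k + M)))\<^sup>2" for k
    using ds(4)[of "k + M"] lr[of "Suc k"] by (simp add: lr)
  note tele = decrease_imp_summable[where l = lr and m = "\<phi>1 z + b"
      and b = "\<lambda>k. C * (norm (u (k + M) - v (k + M)))\<^sup>2", OF _ step lower]
  have "summable (\<lambda>k. C * (norm (u (k + M) - v (k + M)))\<^sup>2)"
    by (rule tele(1)) (use C in simp)
  then have "summable (\<lambda>k. (norm (u (k + M) - v (k + M)))\<^sup>2)"
    using C by simp
  then have "summable (\<lambda>k. (norm (u k - v k))\<^sup>2)"
    using summable_iff_shift[of "\<lambda>k. (norm (u k - v k))\<^sup>2" M] by simp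
  moreover have "convergent lr"
    by (rule tele(2)) (use C in simp)
  then obtain l where "lr \<longlonglongrightarrow> l" by (auto simp: convergent_def)
  then have "(\<lambda>k. \<L> (k + M)) \<longlonglongrightarrow> ereal l" by (simp add: lr)
  then have "\<L> \<longlonglongrightarrow> ereal l" by (rule LIMSEQ_offset)
  ultimately show ?thesis using that by blast
qed

text \<open>The subsequence is shifted by \<open>M\<close> so that all its members satisfy the descent properties.\<close>
lemma descent_sequence_cluster_points:
  assumes ds: "descent_sequence \<gamma> C M u v \<L>" and lim: "\<L> \<longlonglongrightarrow> ereal l"
    and res: "(\<lambda>k. u k - v k) \<longlonglongrightarrow> 0" and x: "x \<in> cluster_points u"
  shows "stationary (total_cost \<phi>1 \<phi>2) x" and "total_cost \<phi>1 \<phi>2 x = ereal l"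
proof -
  have \<gamma>: "0 < \<gamma>" using ds by (simp add: descent_sequence_def)
  obtain r :: "nat \<Rightarrow> nat" where r: "strict_mono r" and "(u \<circ> r) \<longlonglongrightarrow> x"
    using x by (auto simp: cluster_points_def)
  define q where "q n = r (n + M)" for n
  have q: "strict_mono q" using r by (auto simp: q_def strict_mono_def)
  have qM: "M \<le> q n" for n
    using seq_suble[OF r, of "n + M"] by (simp add: q_def)
  have u: "(\<lambda>n. u (q n)) \<longlonglongrightarrow> x"
    using LIMSEQ_ignore_initial_segment[OF \<open>(u \<circ> r) \<longlonglongrightarrow> x\<close>, of M] by (simp add: q_def)
  have "(\<lambda>n. u (q n) - (u (q n) - v (q n))) \<longlonglongrightarrow> x - 0"
    using LIMSEQ_subseq_LIMSEQ[OF res q] by (intro tendsto_diff u) (simp add: o_def)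
  then have v: "(\<lambda>n. v (q n)) \<longlonglongrightarrow> x" by simp
  note ds = descent_sequenceD[OF ds qM]
  define lr where "lr n = real_of_ereal (\<L> (q n))" for n
  have lr: "\<L> (q n) = ereal (lr n)" for n
    using ds(1)[of n] ds(2)[of n] by (auto simp: lr_def fb_model_def)
  have "(\<lambda>n. \<L> (q n)) \<longlonglongrightarrow> ereal l"
    using LIMSEQ_subseq_LIMSEQ[OF lim q] by (simp add: o_def)
  then have "lr \<longlonglongrightarrow> l" by (simp add: lr)
  note limit = limit_minimises_fb_model[OF u v trans[OF ds(2)[symmetric] lr] this ds(3)]
  show "stationary (total_cost \<phi>1 \<phi>2) x" by (rule fb_model_minimal_imp_stationary[OF \<gamma> limit(1)])
  show "total_cost \<phi>1 \<phi>2 x = ereal l"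
    using limit(2) by (simp add: total_cost_def fb_model_def smooth_model_def)
qed

end

theorem theorem4p5:
  fixes \<phi>1 :: "'a::euclidean_space \<Rightarrow> real"
    and \<phi>2 :: "'a \<Rightarrow> ereal"
    and grad :: "'a \<Rightarrow> 'a"
    and K lam L \<gamma> c :: real
    and s0 :: 'a
    and \<Sigma> :: "nat \<Rightarrow> 'a adrs_state"
  assumes "\<And>x. GDERIV \<phi>1 x :> grad x"
    and "K-lipschitz_on UNIV grad"
    and "proper \<phi>2"
    and "lsc \<phi>2"
    and "argmin (total_cost \<phi>1 \<phi>2) \<noteq> {}"
    and "0 < L"
    and "0 < lam" and "lam < 2"
    and "adaptive_params \<phi>1 lam L \<gamma> c"
    and "adrs_run \<phi>1 \<phi>2 lam s0 L \<gamma> c \<Sigma>"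
  shows "\<exists>u v \<L>. adrs_generates \<Sigma> u v \<L> \<and>
     ((\<lambda>k. u k - v k) \<longlonglongrightarrow> 0 \<and>
      (\<lambda>k. MIN i\<in>{..k}. norm (u i - v i)) \<in> o(\<lambda>k. 1 / sqrt (real k))) \<and>
     (cluster_points u = cluster_points v \<and>
      (\<exists>l::real. \<L> \<longlonglongrightarrow> ereal l \<and>
        (\<forall>x \<in> cluster_points u. stationary (total_cost \<phi>1 \<phi>2) x \<and>
                                  total_cost \<phi>1 \<phi>2 x = ereal l)))"
proof -
  interpret composite_problem \<phi>1 \<phi>2 grad K using assms(1-4) by unfold_locales
  obtain u v \<L> \<gamma>' C M where gen: "adrs_generates \<Sigma> u v \<L>" and ds: "descent_sequence \<gamma>' C M u v \<L>"
    using adrs_generates_descent_sequence[OF assms(10,7,6,9)] by blast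
  obtain l where l: "\<L> \<longlonglongrightarrow> ereal l" and summ: "summable (\<lambda>k. (norm (u k - v k))\<^sup>2)"
    using descent_sequence_convergence[OF ds assms(5)] by blast
  have "(\<lambda>k. sqrt ((norm (u k - v k))\<^sup>2)) \<longlonglongrightarrow> sqrt 0"
    by (intro tendsto_real_sqrt summable_LIMSEQ_zero[OF summ])
  then have res: "(\<lambda>k. u k - v k) \<longlonglongrightarrow> 0" by (simp add: tendsto_norm_zero_iff)
  then have "(\<lambda>k. v k - u k) \<longlonglongrightarrow> 0" using tendsto_minus[OF res] by simp
  with res have "cluster_points u = cluster_points v"
    by (intro equalityI cluster_points_subset_of_diff_null)
  moreover have "(\<lambda>k. MIN i\<in>{..k}. norm (u i - v i)) \<in> o(\<lambda>k. 1 / sqrt (real k))"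
    by (rule min_smallo_inverse_sqrt[OF norm_ge_zero summ])
  ultimately show ?thesis
    using gen res l descent_sequence_cluster_points[OF ds l res] by blast
qed

end
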